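(* Let $\mathcal{H}$ be a reproducing kernel Hilbert space on a non-empty set $\Omega$, and let $A,B\in\mathcal{B}(\mathcal{H})$. Then $$\|A+B\|^2_{ber}\leq \|A\|^2_{ber}+\|B\|^2_{ber}+\mathbf{ber}^{\frac{1}{2}}(A^*A)\,\mathbf{ber}^{\frac{1}{2}}(B^*B)+\mathbf{ber}(A^*B).$$
   Context: Let $\mathbb{F}$ be $\mathbb{R}$ or $\mathbb{C}$ and $\Omega$ a non-empty set. A reproducing kernel Hilbert space $\mathcal{H}$ on $\Omega$ is a Hilbert space over $\mathbb{F}$ consisting of functions $\Omega\to\mathbb{F}$ such that every evaluation $f\mapsto f(\lambda)$, $\lambda\in\Omega$, is bounded. For $\lambda\in\Omega$, $k_\lambda\in\mathcal{H}$ is the unique vector with $f(\lambda)=\langle f,k_\lambda\rangle$ for all $f\in\mathcal{H}$; it is assumed that $k_\lambda\neq 0$ for every $\lambda$, and $\hat{k}_\lambda=k_\lambda/\|k_\lambda\|$. $\mathcal{B}(\mathcal{H})$ is the set of bounded linear operators on $\mathcal{H}$. For $A\in\mathcal{B}(\mathcal{H})$, the Berezin number is $\mathbf{ber}(A)=\sup_{\lambda\in\Omega}|\langle A\hat{k}_\lambda,\hat{k}_\lambda\rangle|$, the Berezin norm is $\|A\|_{ber}=\sup_{\lambda,\mu\in\Omega}|\langle A\hat{k}_\lambda,\hat{k}_\mu\rangle|$, and $\mathbf{ber}^{s}(A)$ means $(\mathbf{ber}(A))^{s}$. *)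

theory Defs
  imports Complex_Main "HOL-Library.Function_Algebras"
begin

text \<open>
  The scalar field is a subset \<open>F\<close> of the complex numbers, either \<open>\<real>\<close> or everything, which covers
  the real and the complex case at once; on \<open>\<real>\<close> complex conjugation is the identity.
  A function from \<open>\<Omega>\<close> to \<open>F\<close> is represented by a function that takes values in \<open>F\<close> on \<open>\<Omega>\<close> and
  vanishes off \<open>\<Omega>\<close>, so that equality of representatives is equality on \<open>\<Omega>\<close>.
  Addition and zero of functions (and of operators) are the pointwise ones of
  \<^theory>\<open>HOL-Library.Function_Algebras\<close>.
\<close>

type_synonym 'a inner_prod = "('a \<Rightarrow> complex) \<Rightarrow> ('a \<Rightarrow> complex) \<Rightarrow> complex"
type_synonym 'a operator = "('a \<Rightarrow> complex) \<Rightarrow> ('a \<Rightarrow> complex)"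

definition hnorm :: "'a inner_prod \<Rightarrow> ('a \<Rightarrow> complex) \<Rightarrow> real" where
  "hnorm ip f = sqrt (Re (ip f f))"

locale rkhs =
  fixes F :: "complex set"
    and \<Omega> :: "'a set"
    and H :: "('a \<Rightarrow> complex) set"
    and ip :: "'a inner_prod"
  assumes scalars: "F = \<real> \<or> F = UNIV"
    and nonempty: "\<Omega> \<noteq> {}"
    and values_in: "\<And>f x. f \<in> H \<Longrightarrow> x \<in> \<Omega> \<Longrightarrow> f x \<in> F"
    and off_domain: "\<And>f x. f \<in> H \<Longrightarrow> x \<notin> \<Omega> \<Longrightarrow> f x = 0"
    and zero_in: "0 \<in> H"
    and add_in: "\<And>f g. f \<in> H \<Longrightarrow> g \<in> H \<Longrightarrow> f + g \<in> H"
    and scale_in: "\<And>c f. c \<in> F \<Longrightarrow> f \<in> H \<Longrightarrow> (\<lambda>x. c * f x) \<in> H"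
    and ip_in: "\<And>f g. f \<in> H \<Longrightarrow> g \<in> H \<Longrightarrow> ip f g \<in> F"
    and ip_add_left: "\<And>f g h. f \<in> H \<Longrightarrow> g \<in> H \<Longrightarrow> h \<in> H \<Longrightarrow> ip (f + g) h = ip f h + ip g h"
    and ip_scale_left: "\<And>c f g. c \<in> F \<Longrightarrow> f \<in> H \<Longrightarrow> g \<in> H \<Longrightarrow> ip (\<lambda>x. c * f x) g = c * ip f g"
    and ip_cnj: "\<And>f g. f \<in> H \<Longrightarrow> g \<in> H \<Longrightarrow> ip g f = cnj (ip f g)"
    and ip_pos: "\<And>f. f \<in> H \<Longrightarrow> f \<noteq> 0 \<Longrightarrow> 0 < Re (ip f f)"
    and complete: "\<And>s :: nat \<Rightarrow> 'a \<Rightarrow> complex. (\<And>n. s n \<in> H) \<Longrightarrow>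
          (\<forall>e>0. \<exists>N. \<forall>m\<ge>N. \<forall>n\<ge>N. hnorm ip (s m - s n) < e) \<Longrightarrow>
          \<exists>f\<in>H. (\<lambda>n. hnorm ip (s n - f)) \<longlonglongrightarrow> 0"
    and eval_bounded: "\<And>x. x \<in> \<Omega> \<Longrightarrow> \<exists>M. \<forall>f\<in>H. cmod (f x) \<le> M * hnorm ip f"

definition repro_kernel :: "('a \<Rightarrow> complex) set \<Rightarrow> 'a inner_prod \<Rightarrow> 'a \<Rightarrow> ('a \<Rightarrow> complex)" where
  "repro_kernel H ip l = (THE k. k \<in> H \<and> (\<forall>f\<in>H. f l = ip f k))"

definition normalized_kernel :: "('a \<Rightarrow> complex) set \<Rightarrow> 'a inner_prod \<Rightarrow> 'a \<Rightarrow> ('a \<Rightarrow> complex)" where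
  "normalized_kernel H ip l =
     (\<lambda>x. repro_kernel H ip l x / complex_of_real (hnorm ip (repro_kernel H ip l)))"

text \<open>Operators matter only on \<open>H\<close>; their values off \<open>H\<close> are unconstrained and never used.\<close>

definition bounded_operators ::
    "complex set \<Rightarrow> ('a \<Rightarrow> complex) set \<Rightarrow> 'a inner_prod \<Rightarrow> 'a operator set" where
  "bounded_operators F H ip =
     {A. (\<forall>f\<in>H. A f \<in> H) \<and>
         (\<forall>f\<in>H. \<forall>g\<in>H. A (f + g) = A f + A g) \<and>
         (\<forall>c\<in>F. \<forall>f\<in>H. A (\<lambda>x. c * f x) = (\<lambda>x. c * A f x)) \<and>
         (\<exists>M. \<forall>f\<in>H. hnorm ip (A f) \<le> M * hnorm ip f)}"

definition adjoint_op ::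
    "('a \<Rightarrow> complex) set \<Rightarrow> 'a inner_prod \<Rightarrow> 'a operator \<Rightarrow> 'a operator" where
  "adjoint_op H ip A g = (THE h. h \<in> H \<and> (\<forall>f\<in>H. ip (A f) g = ip f h))"

definition ber ::
    "'a set \<Rightarrow> ('a \<Rightarrow> complex) set \<Rightarrow> 'a inner_prod \<Rightarrow> 'a operator \<Rightarrow> real" where
  "ber \<Omega> H ip A =
     (SUP l\<in>\<Omega>. cmod (ip (A (normalized_kernel H ip l)) (normalized_kernel H ip l)))"

definition berezin_norm ::
    "'a set \<Rightarrow> ('a \<Rightarrow> complex) set \<Rightarrow> 'a inner_prod \<Rightarrow> 'a operator \<Rightarrow> real" where
  "berezin_norm \<Omega> H ip A =
     (SUP (l, m)\<in>\<Omega> \<times> \<Omega>. cmod (ip (A (normalized_kernel H ip l)) (normalized_kernel H ip m)))"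

end

theory Submission
  imports Defs
begin

text \<open>
  Fix normalized kernels \<open>e\<^sub>l\<close> and \<open>e\<^sub>m\<close> and put \<open>a = A e\<^sub>l\<close>, \<open>b = B e\<^sub>l\<close>. Expanding the square,
  \<open>|\<langle>a + b, e\<^sub>m\<rangle>|\<^sup>2\<close> is at most \<open>|\<langle>a, e\<^sub>m\<rangle>|\<^sup>2 + |\<langle>b, e\<^sub>m\<rangle>|\<^sup>2 + 2 |\<langle>a, e\<^sub>m\<rangle>| |\<langle>e\<^sub>m, b\<rangle>|\<close>. The first two terms are
  controlled by the Berezin norms. The mixed term is controlled by Buzano's inequality
  \<open>2 |\<langle>a, e\<rangle>| |\<langle>e, b\<rangle>| \<le> \<parallel>a\<parallel> \<parallel>b\<parallel> + |\<langle>a, b\<rangle>|\<close> for unit vectors \<open>e\<close> (lemma \<open>buzano\<close>), whose right-hand side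
  no longer depends on \<open>m\<close>. Moving operators across the inner product turns it into diagonal
  Berezin values: \<open>\<parallel>a\<parallel>\<^sup>2 = \<langle>A\<^sup>*A e\<^sub>l, e\<^sub>l\<rangle>\<close>, likewise for \<open>b\<close>, and \<open>|\<langle>a, b\<rangle>| = |\<langle>A\<^sup>*B e\<^sub>l, e\<^sub>l\<rangle>|\<close>. The
  supremum over \<open>l\<close> and \<open>m\<close> gives the claim.

  Kernels and adjoints are given by definite descriptions, so their defining properties
  have to be established first. Both are instances of the Riesz representation theorem (lemma
  \<open>riesz\<close>), proved by minimizing the quadratic functional \<open>\<parallel>f\<parallel>\<^sup>2 - 2 Re \<phi>(f)\<close>. This is the only place
  where completeness is used.
\<close>

section \<open>Inner product geometry over a real or complex scalar field\<close>

context rkhs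
begin

abbreviation scale :: "complex \<Rightarrow> ('a \<Rightarrow> complex) \<Rightarrow> 'a \<Rightarrow> complex" where
  "scale c f \<equiv> (\<lambda>x. c * f x)"

abbreviation nrm :: "('a \<Rightarrow> complex) \<Rightarrow> real" where
  "nrm \<equiv> hnorm ip"

lemma of_real_in_scalars: "complex_of_real r \<in> F"
  using scalars by auto

lemma mult_in_scalars: "c \<in> F \<Longrightarrow> d \<in> F \<Longrightarrow> c * d \<in> F"
  using scalars by auto

lemma diff_in_scalars: "c \<in> F \<Longrightarrow> d \<in> F \<Longrightarrow> c - d \<in> F"
  using scalars by auto

lemma cnj_in_scalars: "c \<in> F \<Longrightarrow> cnj c \<in> F"
  using scalars by (auto simp: Reals_cnj_iff)

lemma minus_one_in_scalars: "- 1 \<in> F"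
  using of_real_in_scalars[of "- 1"] by simp

lemma diff_eq_add_scale: "f - g = f + scale (- 1) g"
  by (auto simp: fun_eq_iff)

lemma diff_in: "f \<in> H \<Longrightarrow> g \<in> H \<Longrightarrow> f - g \<in> H"
  unfolding diff_eq_add_scale by (intro add_in scale_in minus_one_in_scalars)

lemma ip_add_right:
  assumes "f \<in> H" "g \<in> H" "h \<in> H"
  shows "ip h (f + g) = ip h f + ip h g"
  using assms ip_cnj[of _ h] by (simp add: ip_add_left add_in)

lemma ip_scale_right:
  assumes "c \<in> F" "f \<in> H" "g \<in> H"
  shows "ip f (scale c g) = cnj c * ip f g"
  using assms ip_cnj[of _ f] by (simp add: ip_scale_left scale_in)

lemma ip_diff_left:
  assumes "f \<in> H" "g \<in> H" "h \<in> H"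
  shows "ip (f - g) h = ip f h - ip g h"
  unfolding diff_eq_add_scale ip_add_left[OF assms(1) scale_in[OF minus_one_in_scalars assms(2)] assms(3)]
    ip_scale_left[OF minus_one_in_scalars assms(2,3)]
  by simp

lemma ip_diff_right:
  assumes "f \<in> H" "g \<in> H" "h \<in> H"
  shows "ip h (f - g) = ip h f - ip h g"
  using assms ip_cnj[of _ h] by (simp add: ip_diff_left diff_in)

lemma ip_zero_left: "g \<in> H \<Longrightarrow> ip 0 g = 0"
  using ip_add_left[OF zero_in zero_in, of g] by simp

lemma Re_ip_self_nonneg: "f \<in> H \<Longrightarrow> 0 \<le> Re (ip f f)"
  using ip_pos[of f] ip_zero_left[OF zero_in] by (cases "f = 0") auto

lemma cmod_ip_commute: "f \<in> H \<Longrightarrow> g \<in> H \<Longrightarrow> cmod (ip g f) = cmod (ip f g)"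
  by (subst ip_cnj) auto

lemma nrm_nonneg: "f \<in> H \<Longrightarrow> 0 \<le> nrm f"
  by (simp add: hnorm_def Re_ip_self_nonneg)

lemma nrm_sq: "f \<in> H \<Longrightarrow> (nrm f)\<^sup>2 = Re (ip f f)"
  by (simp add: hnorm_def Re_ip_self_nonneg)

lemma ip_self: "f \<in> H \<Longrightarrow> ip f f = complex_of_real ((nrm f)\<^sup>2)"
  using ip_cnj[of f f] by (simp add: nrm_sq complex_eq_iff)

lemma nrm_eq_0_iff: "f \<in> H \<Longrightarrow> nrm f = 0 \<longleftrightarrow> f = 0"
  using ip_pos[of f] ip_zero_left[OF zero_in] nrm_sq[of f] by (cases "f = 0") auto

lemma nrm_sq_add:
  assumes "f \<in> H" "g \<in> H"
  shows "(nrm (f + g))\<^sup>2 = (nrm f)\<^sup>2 + (nrm g)\<^sup>2 + 2 * Re (ip f g)"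
  using ip_cnj[OF assms] by (simp add: nrm_sq add_in assms ip_add_left ip_add_right)

lemma nrm_sq_diff:
  assumes "f \<in> H" "g \<in> H"
  shows "(nrm (f - g))\<^sup>2 = (nrm f)\<^sup>2 + (nrm g)\<^sup>2 - 2 * Re (ip f g)"
  using ip_cnj[OF assms] by (simp add: nrm_sq diff_in assms ip_diff_left ip_diff_right)

lemma nrm_sq_scale:
  assumes "c \<in> F" "f \<in> H"
  shows "(nrm (scale c f))\<^sup>2 = (cmod c)\<^sup>2 * (nrm f)\<^sup>2"
proof -
  have "ip (scale c f) (scale c f) = c * cnj c * ip f f"
    using assms by (simp add: ip_scale_left ip_scale_right scale_in)
  also have "\<dots> = complex_of_real ((cmod c)\<^sup>2 * (nrm f)\<^sup>2)"
    using assms by (simp only: ip_self complex_norm_square of_real_mult)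
  finally show ?thesis
    using assms by (simp add: nrm_sq scale_in del: of_real_mult)
qed

text \<open>
  Positivity is applied to \<open>\<parallel>g\<parallel>\<^sup>2 f - \<langle>f, g\<rangle> g\<close>, the component of \<open>f\<close> orthogonal to \<open>g\<close> cleared of its
  denominator.
\<close>

lemma cauchy_schwarz:
  assumes f: "f \<in> H" and g: "g \<in> H"
  shows "cmod (ip f g) \<le> nrm f * nrm g"
proof (cases "g = 0")
  case True
  have "ip f g = cnj (ip g f)"
    by (rule ip_cnj[OF g f])
  then show ?thesis
    using True f by (simp add: ip_zero_left nrm_nonneg zero_in)
next
  case False
  define z where "z = ip f g"
  define N where "N = (nrm g)\<^sup>2"
  have N: "0 < N"
    unfolding N_def using nrm_eq_0_iff[OF g] False by simp
  have z: "z \<in> F"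
    unfolding z_def by (rule ip_in[OF f g])
  have "0 \<le> (nrm (scale (of_real N) f - scale z g))\<^sup>2"
    by simp
  also have "\<dots> = N\<^sup>2 * (nrm f)\<^sup>2 + (cmod z)\<^sup>2 * N - 2 * Re (of_real N * (cnj z * z))"
    using f g z
    by (simp add: nrm_sq_diff nrm_sq_scale scale_in of_real_in_scalars ip_scale_left
        ip_scale_right N_def[symmetric] z_def[symmetric])
  also have "\<dots> = N * (N * (nrm f)\<^sup>2 - (cmod z)\<^sup>2)"
  proof -
    have "Re (of_real N * (cnj z * z)) = N * (cmod z)\<^sup>2"
      by (simp add: cmod_power2[unfolded power2_eq_square] power2_eq_square algebra_simps)
    then show ?thesis
      by (simp add: power2_eq_square algebra_simps)
  qed
  finally have "(cmod z)\<^sup>2 \<le> N * (nrm f)\<^sup>2"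
    using N by (simp add: zero_le_mult_iff)
  then have "(cmod z)\<^sup>2 \<le> (nrm f * nrm g)\<^sup>2"
    by (simp add: N_def power_mult_distrib mult.commute)
  then show ?thesis
    unfolding z_def by (rule power2_le_imp_le) (simp add: f g nrm_nonneg)
qed

text \<open>
  The vector \<open>2 \<langle>a, e\<rangle> e - a\<close> is the reflection of \<open>a\<close> in the line spanned by \<open>e\<close>, so it has the norm
  of \<open>a\<close>. The inequality is Cauchy-Schwarz for this vector and \<open>b\<close>.
\<close>

lemma buzano:
  assumes a: "a \<in> H" and b: "b \<in> H" and e: "e \<in> H" and unit: "nrm e = 1"
  shows "2 * (cmod (ip a e) * cmod (ip e b)) \<le> nrm a * nrm b + cmod (ip a b)"
proof -
  define z where "z = ip a e"
  define v where "v = scale (2 * z) e - a"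
  have z: "2 * z \<in> F"
    unfolding z_def using mult_in_scalars[OF of_real_in_scalars[of 2] ip_in[OF a e]] by simp
  have v: "v \<in> H"
    unfolding v_def using z e a by (intro diff_in scale_in)
  have "Re (2 * z * ip e a) = 2 * (cmod z)\<^sup>2"
    using ip_cnj[OF a e] by (simp add: z_def cmod_power2[unfolded power2_eq_square] power2_eq_square)
  then have "(nrm v)\<^sup>2 = (nrm a)\<^sup>2"
    unfolding v_def using z e a unit
    by (simp add: nrm_sq_diff nrm_sq_scale scale_in ip_scale_left norm_mult power_mult_distrib)
  then have "nrm v = nrm a"
    using v a nrm_nonneg by (simp add: power2_eq_iff_nonneg)
  moreover have "ip v b = 2 * z * ip e b - ip a b"
    unfolding v_def using z e a b by (simp add: ip_diff_left ip_scale_left scale_in)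
  ultimately have "cmod (2 * z * ip e b - ip a b) \<le> nrm a * nrm b"
    using cauchy_schwarz[OF v b] by simp
  then have "cmod (2 * z * ip e b) \<le> nrm a * nrm b + cmod (ip a b)"
    using norm_triangle_ineq2[of "2 * z * ip e b" "ip a b"] by linarith
  then show ?thesis
    by (simp add: norm_mult z_def)
qed


section \<open>Riesz representation\<close>

text \<open>
  By the parallelogram law the functional \<open>J(f) = \<parallel>f\<parallel>\<^sup>2 - 2 Re \<phi>(f)\<close> is uniformly convex, so minimizing
  sequences are Cauchy and \<open>J\<close> attains its infimum at some \<open>k\<close>. The first-order condition at \<open>k\<close> says
  \<open>\<phi>(h) = \<langle>h, k\<rangle>\<close>.
\<close>

lemma riesz:
  fixes \<phi> :: "('a \<Rightarrow> complex) \<Rightarrow> complex"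
  assumes phi_in: "\<And>f. f \<in> H \<Longrightarrow> \<phi> f \<in> F"
    and phi_add: "\<And>f g. f \<in> H \<Longrightarrow> g \<in> H \<Longrightarrow> \<phi> (f + g) = \<phi> f + \<phi> g"
    and phi_scale: "\<And>c f. c \<in> F \<Longrightarrow> f \<in> H \<Longrightarrow> \<phi> (scale c f) = c * \<phi> f"
    and phi_bounded: "\<And>f. f \<in> H \<Longrightarrow> cmod (\<phi> f) \<le> M * nrm f"
  shows "\<exists>!k. k \<in> H \<and> (\<forall>f\<in>H. \<phi> f = ip f k)"
proof -
  define J where "J f = (nrm f)\<^sup>2 - 2 * Re (\<phi> f)" for f
  have Re_phi: "\<bar>Re (\<phi> f)\<bar> \<le> M * nrm f" if "f \<in> H" for f
    using phi_bounded[OF that] abs_Re_le_cmod order_trans by blast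
  have J_lower: "- M\<^sup>2 \<le> J f" if "f \<in> H" for f
  proof -
    have "0 \<le> (nrm f - M)\<^sup>2"
      by simp
    then have "- M\<^sup>2 \<le> (nrm f)\<^sup>2 - 2 * (M * nrm f)"
      by (simp add: power2_diff algebra_simps)
    then show ?thesis
      using Re_phi[OF that] by (simp add: J_def)
  qed
  define d where "d = Inf (J ` H)"
  have d: "d \<le> J f" if "f \<in> H" for f
    unfolding d_def using J_lower that by (intro cInf_lower bdd_belowI2[where m = "- M\<^sup>2"]) auto
  have "\<exists>f\<in>H. J f < d + 1 / real (Suc n)" for n
    using cInf_lessD[of "J ` H" "d + 1 / real (Suc n)"] zero_in by (auto simp: d_def)
  then obtain s where s_in: "\<And>n. s n \<in> H" and s_min: "\<And>n. J (s n) < d + 1 / real (Suc n)"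
    by metis
  have J_convex: "(nrm (f - g))\<^sup>2 \<le> 2 * (J f - d) + 2 * (J g - d)" if f: "f \<in> H" and g: "g \<in> H" for f g
  proof -
    have half: "1 / 2 \<in> F"
      using of_real_in_scalars[of "1 / 2"] by simp
    have mid: "scale (1 / 2) (f + g) \<in> H"
      by (rule scale_in[OF half add_in[OF f g]])
    have "J (scale (1 / 2) (f + g)) = (nrm (f + g))\<^sup>2 / 4 - (Re (\<phi> f) + Re (\<phi> g))"
      unfolding J_def nrm_sq_scale[OF half add_in[OF f g]] phi_scale[OF half add_in[OF f g]]
        phi_add[OF f g]
      by (simp add: power2_eq_square norm_divide field_simps)
    then have "d \<le> (nrm (f + g))\<^sup>2 / 4 - (Re (\<phi> f) + Re (\<phi> g))"
      using d[OF mid] by simp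
    then show ?thesis
      unfolding J_def nrm_sq_add[OF f g] nrm_sq_diff[OF f g] by argo
  qed
  have "\<forall>e>0. \<exists>N. \<forall>m\<ge>N. \<forall>n\<ge>N. nrm (s m - s n) < e"
  proof (intro allI impI)
    fix e :: real
    assume e: "0 < e"
    obtain N where N: "1 / real (Suc N) < e\<^sup>2 / 4"
      using nat_approx_posE[of "e\<^sup>2 / 4"] e by auto
    have near: "J (s n) - d < e\<^sup>2 / 4" if "N \<le> n" for n
    proof -
      have "1 / real (Suc n) \<le> 1 / real (Suc N)"
        using that by (simp add: frac_le)
      then show ?thesis
        using s_min[of n] N by linarith
    qed
    have "nrm (s m - s n) < e" if "N \<le> m" "N \<le> n" for m n
    proof -
      have "(nrm (s m - s n))\<^sup>2 < e\<^sup>2"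
        using J_convex[OF s_in s_in, of m n] near[OF that(1)] near[OF that(2)]
          by (simp add: field_simps)
      then show ?thesis
        by (rule power2_less_imp_less) (use e in simp)
    qed
    then show "\<exists>N. \<forall>m\<ge>N. \<forall>n\<ge>N. nrm (s m - s n) < e"
      by blast
  qed
  then obtain k where k: "k \<in> H" and lim: "(\<lambda>n. nrm (s n - k)) \<longlonglongrightarrow> 0"
    using complete[of s] s_in by blast
  have J_shift: "J (k + h) = J k + (nrm h)\<^sup>2 + 2 * Re (ip h k - \<phi> h)" if "h \<in> H" for h
    using ip_cnj[OF k that] by (simp add: J_def nrm_sq_add[OF k that] phi_add[OF k that])
  have "J k \<le> d"
  proof (rule LIMSEQ_le_const)
    have "(\<lambda>n. d + 1 / real (Suc n) + 2 * (nrm k + M) * nrm (s n - k)) \<longlonglongrightarrow> d + 0 + 2 * (nrm k + M) * 0"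
      by (intro tendsto_intros lim LIMSEQ_inverse_real_of_nat[unfolded inverse_eq_divide])
    then show "(\<lambda>n. d + 1 / real (Suc n) + 2 * (nrm k + M) * nrm (s n - k)) \<longlonglongrightarrow> d"
      by simp
    show "\<exists>N. \<forall>n\<ge>N. J k \<le> d + 1 / real (Suc n) + 2 * (nrm k + M) * nrm (s n - k)"
    proof (intro exI allI impI)
      fix n
      define r where "r = s n - k"
      have r: "r \<in> H"
        unfolding r_def by (rule diff_in[OF s_in k])
      have "J (s n) = J k + (nrm r)\<^sup>2 + 2 * Re (ip r k - \<phi> r)"
        using J_shift[OF r] by (simp add: r_def)
      moreover have "\<bar>Re (ip r k)\<bar> \<le> nrm k * nrm r"
        using cauchy_schwarz[OF r k] abs_Re_le_cmod[of "ip r k"] by (simp add: mult.commute)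
      ultimately have "J k \<le> J (s n) + 2 * (nrm k * nrm r) + 2 * (M * nrm r)"
        using Re_phi[OF r] zero_le_power2[of "nrm r"] unfolding minus_complex.sel by argo
      then show "J k \<le> d + 1 / real (Suc n) + 2 * (nrm k + M) * nrm (s n - k)"
        using s_min[of n] by (simp add: r_def algebra_simps)
    qed
  qed
  have repr: "\<phi> h = ip h k" if h: "h \<in> H" for h
  proof (rule ccontr)
    define z where "z = ip h k - \<phi> h"
    assume "\<phi> h \<noteq> ip h k"
    then have z0: "0 < (cmod z)\<^sup>2"
      by (simp add: z_def)
    \<comment> \<open>A step from \<open>k\<close> in the direction of steepest descent within the line of \<open>h\<close>; the step size
      \<open>t\<close> is small enough for the linear decrease to beat the quadratic term.\<close>
    define t where "t = 1 / ((nrm h)\<^sup>2 + 1)"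
    define c where "c = of_real (- t) * cnj z"
    have c: "c \<in> F"
      unfolding c_def z_def
      by (intro mult_in_scalars of_real_in_scalars cnj_in_scalars diff_in_scalars ip_in phi_in h k)
    have pos: "0 < (nrm h)\<^sup>2 + 1"
      by (simp add: add_nonneg_pos)
    have t: "0 < t" "t * (nrm h)\<^sup>2 < 1"
      using pos by (simp_all add: t_def)
    have "Re (c * z) = - t * (cmod z)\<^sup>2"
      by (simp add: c_def cmod_power2[unfolded power2_eq_square] power2_eq_square algebra_simps)
    moreover have "(cmod c)\<^sup>2 = t\<^sup>2 * (cmod z)\<^sup>2"
      by (simp add: c_def norm_mult power_mult_distrib)
    moreover have "ip (scale c h) k - \<phi> (scale c h) = c * z"
      by (simp add: z_def ip_scale_left[OF c h k] phi_scale[OF c h] algebra_simps)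
    ultimately have "J (k + scale c h) = J k + t\<^sup>2 * (cmod z)\<^sup>2 * (nrm h)\<^sup>2 - 2 * t * (cmod z)\<^sup>2"
      using J_shift[OF scale_in[OF c h]] nrm_sq_scale[OF c h] by simp
    also have "\<dots> = J k + t * (cmod z)\<^sup>2 * (t * (nrm h)\<^sup>2 - 2)"
      by (simp add: power2_eq_square algebra_simps)
    also have "\<dots> < J k"
      using t z0 by (simp add: mult_pos_neg)
    finally show False
      using d[OF add_in[OF k scale_in[OF c h]]] \<open>J k \<le> d\<close> by linarith
  qed
  show ?thesis
  proof (rule ex1I[of _ k])
    show "k \<in> H \<and> (\<forall>f\<in>H. \<phi> f = ip f k)"
      using k repr by blast
    fix k'
    assume k': "k' \<in> H \<and> (\<forall>f\<in>H. \<phi> f = ip f k')"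
    then have diff: "k' - k \<in> H"
      using k diff_in by blast
    then have "ip (k' - k) (k' - k) = 0"
      using k k' diff repr[OF diff] by (simp add: ip_diff_right)
    then have "nrm (k' - k) = 0"
      by (simp add: hnorm_def)
    then show "k' = k"
      using nrm_eq_0_iff[OF diff] by simp
  qed
qed


section \<open>Kernels, adjoints and Berezin suprema\<close>

lemma repro_kernel_in:
  assumes l: "l \<in> \<Omega>"
  shows "repro_kernel H ip l \<in> H"
proof -
  obtain M where M: "\<And>f. f \<in> H \<Longrightarrow> cmod (f l) \<le> M * nrm f"
    using eval_bounded[OF l] by blast
  have "\<exists>!k. k \<in> H \<and> (\<forall>f\<in>H. f l = ip f k)"
    by (rule riesz[where M = M]) (simp_all add: l values_in M)
  from theI'[OF this] show ?thesis
    unfolding repro_kernel_def by blast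
qed

lemma normalized_kernel:
  assumes l: "l \<in> \<Omega>" and nz: "repro_kernel H ip l \<noteq> 0"
  shows normalized_kernel_in: "normalized_kernel H ip l \<in> H"
    and nrm_normalized_kernel: "nrm (normalized_kernel H ip l) = 1"
proof -
  let ?k = "repro_kernel H ip l"
  have k: "?k \<in> H"
    by (rule repro_kernel_in[OF l])
  have eq: "normalized_kernel H ip l = scale (of_real (1 / nrm ?k)) ?k"
    by (simp add: normalized_kernel_def fun_eq_iff)
  show in_H: "normalized_kernel H ip l \<in> H"
    unfolding eq by (rule scale_in[OF of_real_in_scalars k])
  have "(nrm (normalized_kernel H ip l))\<^sup>2 = 1"
    unfolding eq nrm_sq_scale[OF of_real_in_scalars k]
    using nrm_eq_0_iff[OF k] nz by (simp add: norm_divide power_divide)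
  then show "nrm (normalized_kernel H ip l) = 1"
    using nrm_nonneg[OF in_H] by (simp add: power2_eq_1_iff)
qed

lemma bounded_operators_closed: "A \<in> bounded_operators F H ip \<Longrightarrow> f \<in> H \<Longrightarrow> A f \<in> H"
  by (simp add: bounded_operators_def)

lemma bounded_operators_bound:
  assumes "A \<in> bounded_operators F H ip"
  obtains M where "0 \<le> M" "\<And>f. f \<in> H \<Longrightarrow> nrm (A f) \<le> M * nrm f"
proof -
  obtain M where M: "\<And>f. f \<in> H \<Longrightarrow> nrm (A f) \<le> M * nrm f"
    using assms unfolding bounded_operators_def by blast
  have "nrm (A f) \<le> max 0 M * nrm f" if "f \<in> H" for f
    using M[OF that] mult_right_mono[OF max.cobounded2 nrm_nonneg[OF that], of M 0] by linarith
  then show thesis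
    using that[of "max 0 M"] by simp
qed

lemma adjoint_op:
  assumes A: "A \<in> bounded_operators F H ip" and g: "g \<in> H"
  shows adjoint_op_in: "adjoint_op H ip A g \<in> H"
    and ip_adjoint_op: "f \<in> H \<Longrightarrow> ip f (adjoint_op H ip A g) = ip (A f) g"
proof -
  obtain M where M: "\<And>f. f \<in> H \<Longrightarrow> nrm (A f) \<le> M * nrm f"
    using bounded_operators_bound[OF A] by blast
  have "\<exists>!h. h \<in> H \<and> (\<forall>f\<in>H. ip (A f) g = ip f h)"
  proof (rule riesz[where M = "M * nrm g"])
    fix f
    assume f: "f \<in> H"
    have "cmod (ip (A f) g) \<le> nrm (A f) * nrm g"
      by (rule cauchy_schwarz[OF bounded_operators_closed[OF A f] g])
    also have "\<dots> \<le> M * nrm f * nrm g"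
      by (rule mult_right_mono[OF M[OF f] nrm_nonneg[OF g]])
    finally show "cmod (ip (A f) g) \<le> M * nrm g * nrm f"
      by (simp add: mult_ac)
  qed (use A g in \<open>auto simp: bounded_operators_def ip_in ip_add_left ip_scale_left\<close>)
  from theI'[OF this] show "adjoint_op H ip A g \<in> H"
    and "f \<in> H \<Longrightarrow> ip f (adjoint_op H ip A g) = ip (A f) g"
    unfolding adjoint_op_def by auto
qed

lemma cmod_ip_adjoint_comp:
  assumes A: "A \<in> bounded_operators F H ip" and B: "B \<in> bounded_operators F H ip" and f: "f \<in> H"
  shows "cmod (ip ((adjoint_op H ip A \<circ> B) f) f) = cmod (ip (A f) (B f))"
proof -
  have Bf: "B f \<in> H"
    by (rule bounded_operators_closed[OF B f])
  show ?thesis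
    using cmod_ip_commute[OF f adjoint_op_in[OF A Bf]] ip_adjoint_op[OF A Bf f] by simp
qed

text \<open>
  A supremum of reals dominates its members only if they are bounded above; the operator bounds
  of \<open>A\<close> and \<open>B\<close> provide this, here and in \<open>cmod_le_berezin_norm\<close>.
\<close>

lemma cmod_le_ber_adjoint_comp:
  assumes nz: "\<And>l. l \<in> \<Omega> \<Longrightarrow> repro_kernel H ip l \<noteq> 0"
    and A: "A \<in> bounded_operators F H ip" and B: "B \<in> bounded_operators F H ip"
    and l: "l \<in> \<Omega>"
  defines "e \<equiv> normalized_kernel H ip"
  shows "cmod (ip (A (e l)) (B (e l))) \<le> ber \<Omega> H ip (adjoint_op H ip A \<circ> B)"
proof -
  obtain MA where MA: "0 \<le> MA" "\<And>f. f \<in> H \<Longrightarrow> nrm (A f) \<le> MA * nrm f"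
    using bounded_operators_bound[OF A] by blast
  obtain MB where MB: "\<And>f. f \<in> H \<Longrightarrow> nrm (B f) \<le> MB * nrm f"
    using bounded_operators_bound[OF B] by blast
  let ?g = "\<lambda>l. cmod (ip ((adjoint_op H ip A \<circ> B) (e l)) (e l))"
  have eq: "?g x = cmod (ip (A (e x)) (B (e x)))" if "x \<in> \<Omega>" for x
    unfolding e_def by (rule cmod_ip_adjoint_comp[OF A B normalized_kernel_in[OF that nz[OF that]]])
  have "?g x \<le> MA * MB" if x: "x \<in> \<Omega>" for x
  proof -
    have e: "e x \<in> H" "nrm (e x) = 1"
      unfolding e_def using normalized_kernel[OF x nz[OF x]] by auto
    have "?g x \<le> nrm (A (e x)) * nrm (B (e x))"
      unfolding eq[OF x] by (intro cauchy_schwarz bounded_operators_closed[OF A] bounded_operators_closed[OF B] e)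
    also have "\<dots> \<le> MA * MB"
      using MA(2)[OF e(1)] MB[OF e(1)] e MA(1) nrm_nonneg bounded_operators_closed[OF B e(1)]
      by (intro mult_mono) auto
    finally show ?thesis .
  qed
  then have "?g l \<le> (SUP x\<in>\<Omega>. ?g x)"
    by (intro cSUP_upper l bdd_aboveI2) auto
  then show ?thesis
    using eq[OF l] by (simp add: ber_def e_def)
qed

lemma nrm_le_sqrt_ber:
  assumes nz: "\<And>l. l \<in> \<Omega> \<Longrightarrow> repro_kernel H ip l \<noteq> 0"
    and A: "A \<in> bounded_operators F H ip" and l: "l \<in> \<Omega>"
  shows "nrm (A (normalized_kernel H ip l)) \<le> ber \<Omega> H ip (adjoint_op H ip A \<circ> A) powr (1/2)"
proof -
  let ?a = "A (normalized_kernel H ip l)"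
  have a: "?a \<in> H"
    by (intro bounded_operators_closed[OF A] normalized_kernel_in l nz)
  have le: "(nrm ?a)\<^sup>2 \<le> ber \<Omega> H ip (adjoint_op H ip A \<circ> A)"
    using cmod_le_ber_adjoint_comp[OF nz A A l] by (simp add: ip_self[OF a] norm_power)
  have "0 \<le> ber \<Omega> H ip (adjoint_op H ip A \<circ> A)"
    using le zero_le_power2[of "nrm ?a"] by linarith
  then show ?thesis
    using real_le_rsqrt[OF le] by (simp add: powr_half_sqrt)
qed

lemma cmod_le_berezin_norm:
  assumes nz: "\<And>l. l \<in> \<Omega> \<Longrightarrow> repro_kernel H ip l \<noteq> 0"
    and A: "A \<in> bounded_operators F H ip" and l: "l \<in> \<Omega>" and m: "m \<in> \<Omega>"
  shows "cmod (ip (A (normalized_kernel H ip l)) (normalized_kernel H ip m)) \<le> berezin_norm \<Omega> H ip A"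
proof -
  let ?e = "normalized_kernel H ip"
  obtain M where M: "\<And>f. f \<in> H \<Longrightarrow> nrm (A f) \<le> M * nrm f"
    using bounded_operators_bound[OF A] by blast
  have "cmod (ip (A (?e x)) (?e y)) \<le> M" if x: "x \<in> \<Omega>" and y: "y \<in> \<Omega>" for x y
  proof -
    note ex = normalized_kernel[OF x nz[OF x]] and ey = normalized_kernel[OF y nz[OF y]]
    have "cmod (ip (A (?e x)) (?e y)) \<le> nrm (A (?e x)) * nrm (?e y)"
      by (intro cauchy_schwarz bounded_operators_closed[OF A] ex ey)
    also have "\<dots> \<le> M"
      using M[OF ex(1)] ex ey by simp
    finally show ?thesis .
  qed
  then have "(\<lambda>(l, m). cmod (ip (A (?e l)) (?e m))) (l, m)
      \<le> (SUP (l, m)\<in>\<Omega> \<times> \<Omega>. cmod (ip (A (?e l)) (?e m)))"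
    using l m by (intro cSUP_upper bdd_aboveI2[where M = M]) auto
  then show ?thesis
    by (simp add: berezin_norm_def)
qed

end


section \<open>The Berezin norm of a sum\<close>

theorem theorem3p2:
  fixes F :: "complex set" and \<Omega> :: "'a set"
    and H :: "('a \<Rightarrow> complex) set" and ip :: "'a inner_prod"
    and A B :: "'a operator"
  assumes "rkhs F \<Omega> H ip"
    and "\<And>l. l \<in> \<Omega> \<Longrightarrow> repro_kernel H ip l \<noteq> 0"
    and "A \<in> bounded_operators F H ip"
    and "B \<in> bounded_operators F H ip"
  shows "(berezin_norm \<Omega> H ip (A + B))\<^sup>2
    \<le> (berezin_norm \<Omega> H ip A)\<^sup>2 + (berezin_norm \<Omega> H ip B)\<^sup>2
      + ber \<Omega> H ip (adjoint_op H ip A \<circ> A) powr (1/2) * ber \<Omega> H ip (adjoint_op H ip B \<circ> B) powr (1/2)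
      + ber \<Omega> H ip (adjoint_op H ip A \<circ> B)"
    (is "_ \<le> ?R")
proof -
  interpret rkhs F \<Omega> H ip
    by (rule assms(1))
  note nz = assms(2) and A = assms(3) and B = assms(4)
  let ?e = "normalized_kernel H ip"
  have pointwise: "(cmod (ip ((A + B) (?e l)) (?e m)))\<^sup>2 \<le> ?R" if l: "l \<in> \<Omega>" and m: "m \<in> \<Omega>" for l m
  proof -
    define a b e where "a = A (?e l)" and "b = B (?e l)" and "e = ?e m"
    have a: "a \<in> H" and b: "b \<in> H"
      unfolding a_def b_def
      by (intro bounded_operators_closed[OF A] bounded_operators_closed[OF B]
          normalized_kernel_in[OF l nz[OF l]])+
    have e: "e \<in> H" "nrm e = 1"
      unfolding e_def using normalized_kernel[OF m nz[OF m]] by auto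
    have "(cmod (ip ((A + B) (?e l)) (?e m)))\<^sup>2 = (cmod (ip a e + ip b e))\<^sup>2"
      using ip_add_left[OF a b e(1)] by (simp add: a_def b_def e_def)
    also have "\<dots> \<le> (cmod (ip a e) + cmod (ip b e))\<^sup>2"
      by (intro power_mono norm_triangle_ineq) simp
    also have "\<dots> = (cmod (ip a e))\<^sup>2 + (cmod (ip b e))\<^sup>2 + 2 * (cmod (ip a e) * cmod (ip e b))"
      using cmod_ip_commute[OF b e(1)] by (simp add: power2_sum)
    also have "\<dots> \<le> (cmod (ip a e))\<^sup>2 + (cmod (ip b e))\<^sup>2 + (nrm a * nrm b + cmod (ip a b))"
      using buzano[OF a b e] by simp
    also have "\<dots> \<le> (berezin_norm \<Omega> H ip A)\<^sup>2 + (berezin_norm \<Omega> H ip B)\<^sup>2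
        + (ber \<Omega> H ip (adjoint_op H ip A \<circ> A) powr (1/2) * ber \<Omega> H ip (adjoint_op H ip B \<circ> B) powr (1/2)
          + ber \<Omega> H ip (adjoint_op H ip A \<circ> B))"
    proof (intro add_mono power_mono mult_mono)
      show "cmod (ip a e) \<le> berezin_norm \<Omega> H ip A" "cmod (ip b e) \<le> berezin_norm \<Omega> H ip B"
        unfolding a_def b_def e_def using cmod_le_berezin_norm[OF nz _ l m] A B by auto
      show "nrm a \<le> ber \<Omega> H ip (adjoint_op H ip A \<circ> A) powr (1/2)"
        "nrm b \<le> ber \<Omega> H ip (adjoint_op H ip B \<circ> B) powr (1/2)"
        unfolding a_def b_def using nrm_le_sqrt_ber[OF nz _ l] A B by auto
      show "cmod (ip a b) \<le> ber \<Omega> H ip (adjoint_op H ip A \<circ> B)"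
        unfolding a_def b_def by (rule cmod_le_ber_adjoint_comp[OF nz A B l])
    qed (use nrm_nonneg[OF b] in auto)
    finally show ?thesis
      by simp
  qed
  obtain l where l: "l \<in> \<Omega>"
    using nonempty by blast
  let ?V = "\<lambda>(l, m). cmod (ip ((A + B) (?e l)) (?e m))"
  have V_le: "?V p \<le> sqrt ?R" if "p \<in> \<Omega> \<times> \<Omega>" for p
    using that pointwise by (auto intro: real_le_rsqrt)
  have upper: "berezin_norm \<Omega> H ip (A + B) \<le> sqrt ?R"
    unfolding berezin_norm_def[where A = "A + B"] using l V_le by (intro cSUP_least) auto
  have "?V (l, l) \<le> berezin_norm \<Omega> H ip (A + B)"
    unfolding berezin_norm_def[where A = "A + B"] using l V_le by (intro cSUP_upper bdd_aboveI2) auto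
  then have lower: "0 \<le> berezin_norm \<Omega> H ip (A + B)"
    by (rule order_trans[rotated]) simp
  have "0 \<le> ?R"
    using pointwise[OF l l] by (rule order_trans[rotated]) simp
  then show ?thesis
    using power_mono[OF upper lower, of 2] by (simp only: real_sqrt_pow2)
qed

end
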